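(* Let $0<q<1$ and $0<a<1$. Then the $a;q$-numbers $[x]_{a;q}$ are continuously strongly log-concave in $x$; that is, for all real $x\ge y\ge r\ge 0$, $$[x]_{a;q}\,[y]_{a;q}\ \ge\ [x+r]_{a;q}\,[y-r]_{a;q}.$$
   Context: The $a;q$-number of $x$ is defined by $$[x]_{a;q}:=\frac{(1-q^x)(1-aq^x)}{(1-q)(1-aq)}\,q^{1-x}.$$ *)

theory Defs
  imports Complex_Main
begin

definition aq_number :: "real \<Rightarrow> real \<Rightarrow> real \<Rightarrow> real" where
  "aq_number a q x =
     ((1 - q powr x) * (1 - a * q powr x)) / ((1 - q) * (1 - a * q)) * q powr (1 - x)"

text \<open>Only the values of \<open>f\<close> on the nonnegative reals matter: the constraints force
  \<open>y - r \<ge> 0\<close>. No sign condition on \<open>f\<close> is included.\<close>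

definition continuously_strongly_log_concave :: "(real \<Rightarrow> real) \<Rightarrow> bool" where
  "continuously_strongly_log_concave f \<longleftrightarrow>
     (\<forall>x y r. x \<ge> y \<and> y \<ge> r \<and> r \<ge> 0 \<longrightarrow> f x * f y \<ge> f (x + r) * f (y - r))"

end

(* The factor q^(1-x) is log-linear, so with X = q^x, Z = q^(y-r), R = q^r it cancels, and for c = 1
   and c = a one has (1 - cX)(1 - cZR) - (1 - cXR)(1 - cZ) = c (Z - X)(1 - R) \<ge> 0.
   All factors are nonnegative, so the two inequalities can be multiplied. *)
theory Submission
  imports Defs
begin

text \<open>Log-concavity of \<open>1 - c * q powr t\<close> in \<open>t\<close>, in multiplicative
  form: a factor \<open>R\<close> stands for a shift of the exponent by \<open>r\<close>.\<close>

lemma one_minus_mult_log_concave: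
  fixes c X Z R :: real
  assumes "0 \<le> c" "X \<le> Z" "R \<le> 1"
  shows "(1 - c * (X * R)) * (1 - c * Z) \<le> (1 - c * X) * (1 - c * (Z * R))"
proof -
  have "(1 - c * X) * (1 - c * (Z * R)) - (1 - c * (X * R)) * (1 - c * Z) = c * (Z - X) * (1 - R)"
    by algebra
  moreover have "0 \<le> c * (Z - X) * (1 - R)"
    using assms by simp
  ultimately show ?thesis
    by linarith
qed

theorem theorem5:
  fixes a q :: real
  assumes "0 < q" and "q < 1" and "0 < a" and "a < 1"
  shows "continuously_strongly_log_concave (\<lambda>x. aq_number a q x)"
  unfolding continuously_strongly_log_concave_def
proof (intro allI impI)
  fix x y r :: real
  assume "x \<ge> y \<and> y \<ge> r \<and> r \<ge> 0"
  then have xyr: "y \<le> x" "r \<le> y" "0 \<le> r" by auto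
  \<comment> \<open>Taking \<open>y - r\<close> rather than \<open>y\<close> as base point makes all
    four powers of \<open>q\<close> monomials in \<open>X\<close>, \<open>Z\<close>,
    \<open>R\<close>, with no division.\<close>
  define X Z R where "X = q powr x" and "Z = q powr (y - r)" and "R = q powr r"
  have powr_xr: "q powr (x + r) = X * R" and powr_y: "q powr y = Z * R"
    by (simp_all add: X_def Z_def R_def flip: powr_add)
  have le_1: "q powr t \<le> 1" if "0 \<le> t" for t
    using powr_mono'[of 0 t q] that assms by simp
  \<comment> \<open>Here \<open>y - r \<le> x\<close>, and powers of a base below 1 decrease in the
    exponent.\<close>
  have "X \<le> Z"
    unfolding X_def Z_def using xyr assms by (intro powr_mono') auto
  have "Z \<le> 1" "R \<le> 1" "X * R \<le> 1" "X \<le> 1" "Z * R \<le> 1"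
    using le_1[of "y - r"] le_1[of r] le_1[of "x + r"] le_1[of x] le_1[of y] xyr
    by (auto simp: X_def Z_def R_def simp flip: powr_add)
  have scaled: "a * t \<le> 1" if "t \<le> 1" for t
    using mult_left_mono[OF that, of a] assms by linarith
  have "((1 - X * R) * (1 - Z)) * ((1 - a * (X * R)) * (1 - a * Z))
      \<le> ((1 - X) * (1 - Z * R)) * ((1 - a * X) * (1 - a * (Z * R)))"
    using one_minus_mult_log_concave[of 1 X Z R] one_minus_mult_log_concave[of a X Z R] assms
      \<open>X \<le> Z\<close> \<open>R \<le> 1\<close> \<open>X * R \<le> 1\<close> \<open>X \<le> 1\<close> \<open>Z * R \<le> 1\<close> \<open>Z \<le> 1\<close> scaled
    \<comment> \<open>The patterns force both factors to be products. This stops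
      \<open>mult_mono\<close> from splitting further, down to \<open>1 - X * R \<le> 1 - X\<close>,
      which is false in general.\<close>
    by (intro mult_mono[where a = "_ * _" and c = "_ * _"] mult_nonneg_nonneg) auto
  \<comment> \<open>\<open>K\<close> collects the denominators and the powers
    \<open>q powr (1 - s)\<close> and \<open>q powr (1 - t)\<close>. It depends on \<open>s\<close>
    and \<open>t\<close> only through \<open>s + t\<close>, so the pairs \<open>x\<close>,
    \<open>y\<close> and \<open>x + r\<close>, \<open>y - r\<close> share it.\<close>
  moreover define K where "K = q powr (2 - x - y) / ((1 - q) * (1 - a * q))\<^sup>2"
  ultimately have "((1 - X * R) * (1 - Z)) * ((1 - a * (X * R)) * (1 - a * Z)) * K
      \<le> ((1 - X) * (1 - Z * R)) * ((1 - a * X) * (1 - a * (Z * R))) * K"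
    by (intro mult_right_mono) auto
  moreover have "aq_number a q s * aq_number a q t =
      ((1 - q powr s) * (1 - q powr t)) * ((1 - a * q powr s) * (1 - a * q powr t)) * K"
    if "s + t = x + y" for s t
  proof -
    have "2 - x - y = (1 - s) + (1 - t)"
      using that by linarith
    then have "q powr (2 - x - y) = q powr (1 - s) * q powr (1 - t)"
      by (simp only: powr_add)
    then show ?thesis
      by (simp add: aq_number_def K_def power2_eq_square)
  qed
  from this[of x y] this[of "x + r" "y - r"]
  have "aq_number a q x * aq_number a q y =
      ((1 - X) * (1 - Z * R)) * ((1 - a * X) * (1 - a * (Z * R))) * K"
    and "aq_number a q (x + r) * aq_number a q (y - r) =
      ((1 - X * R) * (1 - Z)) * ((1 - a * (X * R)) * (1 - a * Z)) * K"
    by (simp_all add: powr_xr powr_y flip: X_def Z_def)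
  ultimately show "aq_number a q (x + r) * aq_number a q (y - r) \<le> aq_number a q x * aq_number a q y"
    by simp
qed

end
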